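(* Let $q$ be a non-zero real number and let $P_n$ be the path on $n\ge 6$ vertices. By adding the edges $\{2,n-2\}$ and $\{3,n-1\}$ and assigning a potential of $2$ to the end vertices $1$ and $n$, the resulting graph admits $q$-Laplacian perfect pair state transfer.
   Context: $P_n$ is the (unweighted) path on vertices $1,\dots,n$ with $j,k$ adjacent iff $|j-k|=1$. For a graph with adjacency matrix $A$, diagonal degree matrix $\Delta$, and vertex potential $\eta$ with diagonal matrix $\Delta'$, $\Delta'_{vv}=\eta(v)$, the $q$-Laplacian matrix is $\mathscr{L}=(1-q^2)I+q^2(\Delta+\Delta')-qA$. Here $\eta(1)=\eta(n)=2$ and $\eta$ is zero at all other vertices. A pair state is a vector $\frac{1}{\sqrt2}(\mathbf{e}_a-\mathbf{e}_b)$ with $a\ne b$ vertices, where $\mathbf{e}_a$ is the characteristic vector of $a$. Perfect pair state transfer means there are two linearly independent pair states $\mathbf{x},\mathbf{y}$, some $\tau>0$ and $\gamma\in\mathbb{C}$ with $\exp(i\tau\mathscr{L})\mathbf{x}=\gamma\mathbf{y}$. *)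

theory Defs
  imports "HOL-Analysis.Analysis" "Jordan_Normal_Form.VS_Connect" "Jordan_Normal_Form.Jordan_Normal_Form"
begin

text \<open>
  A simple graph on the vertex set \<open>{1..n}\<close> is given by its set of edges, each edge being a
  two-element set of vertices. Rows and columns of matrices and entries of vectors are
  numbered from \<open>0\<close>, so that vertex \<open>v\<close> corresponds to index \<open>v - 1\<close> and index \<open>i\<close> to
  vertex \<open>Suc i\<close>.
\<close>

definition path_edges :: "nat \<Rightarrow> nat set set" where
  "path_edges n = {{j, k} | j k. j \<in> {1..n} \<and> k \<in> {1..n} \<and> \<bar>int j - int k\<bar> = 1}"

definition adjacency_mat :: "nat \<Rightarrow> nat set set \<Rightarrow> real mat" where
  "adjacency_mat n E = mat n n (\<lambda>(i, j). if {Suc i, Suc j} \<in> E then 1 else 0)"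

definition graph_degree :: "nat set set \<Rightarrow> nat \<Rightarrow> nat" where
  "graph_degree E v = card {e \<in> E. v \<in> e}"

definition vertex_diag_mat :: "nat \<Rightarrow> (nat \<Rightarrow> real) \<Rightarrow> real mat" where
  "vertex_diag_mat n f = mat n n (\<lambda>(i, j). if i = j then f (Suc i) else 0)"

definition q_laplacian :: "nat \<Rightarrow> nat set set \<Rightarrow> (nat \<Rightarrow> real) \<Rightarrow> real \<Rightarrow> real mat" where
  "q_laplacian n E \<eta> q =
     (1 - q\<^sup>2) \<cdot>\<^sub>m 1\<^sub>m n
     + q\<^sup>2 \<cdot>\<^sub>m (vertex_diag_mat n (\<lambda>v. real (graph_degree E v)) + vertex_diag_mat n \<eta>)
     - q \<cdot>\<^sub>m adjacency_mat n E"

text \<open>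
  The exponential series, entry by entry; it is meant for square matrices, for which
  it converges, see \<open>mat_exp_sums\<close> below.
\<close>

definition mat_exp :: "complex mat \<Rightarrow> complex mat" where
  "mat_exp A = mat (dim_row A) (dim_row A) (\<lambda>(i, j). \<Sum>k. (A ^\<^sub>m k) $$ (i, j) / fact k)"

definition char_vec :: "nat \<Rightarrow> nat \<Rightarrow> complex vec" where
  "char_vec n a = unit_vec n (a - 1)"

definition pair_state :: "nat \<Rightarrow> complex vec \<Rightarrow> bool" where
  "pair_state n x \<longleftrightarrow>
     (\<exists>a\<in>{1..n}. \<exists>b\<in>{1..n}. a \<noteq> b \<and>
        x = complex_of_real (1 / sqrt 2) \<cdot>\<^sub>v (char_vec n a - char_vec n b))"

text \<open>
  The library's linear (in)dependence is a property of sets of vectors, hence the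
  extra condition \<open>x \<noteq> y\<close>. The scalars are the complex numbers.
\<close>

definition lin_indep_pair :: "nat \<Rightarrow> complex vec \<Rightarrow> complex vec \<Rightarrow> bool" where
  "lin_indep_pair n x y \<longleftrightarrow>
     x \<noteq> y \<and> \<not> LinearCombinations.module.lin_dep class_ring (module_vec TYPE(complex) n) {x, y}"

definition q_laplacian_perfect_pair_state_transfer ::
    "nat \<Rightarrow> nat set set \<Rightarrow> (nat \<Rightarrow> real) \<Rightarrow> real \<Rightarrow> bool" where
  "q_laplacian_perfect_pair_state_transfer n E \<eta> q \<longleftrightarrow>
     (\<exists>x y. pair_state n x \<and> pair_state n y \<and> lin_indep_pair n x y \<and>
        (\<exists>\<tau>::real. \<tau> > 0 \<and> (\<exists>\<gamma>::complex.
           mat_exp ((\<i> * complex_of_real \<tau>) \<cdot>\<^sub>m map_mat complex_of_real (q_laplacian n E \<eta> q)) *\<^sub>v x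
             = \<gamma> \<cdot>\<^sub>v y)))"

lemma mat_exp_sums:
  assumes A: "A \<in> carrier_mat n n" and "i < n" "j < n"
  shows "(\<lambda>k. (A ^\<^sub>m k) $$ (i, j) / fact k) sums (mat_exp A $$ (i, j))"
proof -
  obtain b where b: "norm_bound A b"
    using norm_bound_max by blast
  have bnd: "norm_bound (A ^\<^sub>m k) ((b * real n) ^ k)" for k
  proof (induction k)
    case 0
    show ?case by (auto simp: norm_bound_def one_mat_def)
  next
    case (Suc k)
    have "norm_bound (A ^\<^sub>m k * A) ((b * real n) ^ k * b * of_nat n)"
      by (rule norm_bound_mult[OF pow_carrier_mat[OF A] A Suc b])
    then show ?case by (simp add: mult_ac)
  qed
  have "summable (\<lambda>k. (A ^\<^sub>m k) $$ (i, j) / fact k)"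
  proof (rule summable_comparison_test')
    show "summable (\<lambda>k. (b * real n) ^ k / fact k)"
      using summable_exp[of "b * real n"] by (simp add: field_simps)
    show "norm ((A ^\<^sub>m k) $$ (i, j) / fact k) \<le> (b * real n) ^ k / fact k" if "k \<ge> 0" for k
      using bnd[of k] assms pow_carrier_mat[OF A, of k]
      by (auto simp: norm_bound_def norm_divide intro!: divide_right_mono)
  qed
  then show ?thesis
    using assms by (auto simp: mat_exp_def summable_sums)
qed

end

theory Submission
  imports Defs
begin

text \<open>
  The construction is invariant under the reflection \<open>v \<mapsto> n + 1 - v\<close>, so the
  \<open>q\<close>-Laplacian \<open>L\<close> preserves the space of antisymmetric vectors, which contains
  \<open>x = e\<^sub>1 - e\<^sub>n\<close> and \<open>y = e\<^sub>2 - e\<^bsub>n-1\<^esub>\<close>. In the plain path, \<open>y\<close> is also coupled to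
  \<open>e\<^sub>3 - e\<^bsub>n-2\<^esub>\<close>. The two chords remove this coupling: they make both \<open>3\<close> and \<open>n - 2\<close>
  common neighbours of \<open>2\<close> and \<open>n - 1\<close>, whose contributions cancel in the difference. Hence \<open>x\<close>
  and \<open>y\<close> span an \<open>L\<close>-invariant plane. The potential raises the diagonal entries at the
  ends, which have degree \<open>1\<close>, to those at \<open>2\<close> and \<open>n - 1\<close>, which have degree \<open>3\<close>. So on the
  plane \<open>L\<close> acts as on a single edge:
  \<open>L x = (1 + 2 q\<^sup>2) x - q y\<close> and \<open>L y = (1 + 2 q\<^sup>2) y - q x\<close>; see
  \<open>q_laplacian_chorded_path_column_differences\<close>.

  The vectors \<open>x + y\<close> and \<open>x - y\<close> are then eigenvectors whose eigenvalues differ by \<open>2 q\<close>. At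
  time \<open>\<tau> = \<pi> / (2 \<bar>q\<bar>)\<close> their phases have become opposite, and a linear map that sends
  \<open>x + y\<close> to \<open>g (x + y)\<close> and \<open>x - y\<close> to \<open>- g (x - y)\<close> sends \<open>x\<close> to \<open>g y\<close>; see
  \<open>mat_exp_swap\<close>.
\<close>

unbundle no vec_syntax

section \<open>Matrix exponentials on eigenvectors\<close>

lemma mat_exp_mult_eigenvector:
  assumes A: "A \<in> carrier_mat n n" and v: "v \<in> carrier_vec n"
    and eig: "A *\<^sub>v v = c \<cdot>\<^sub>v v"
  shows "mat_exp A *\<^sub>v v = exp c \<cdot>\<^sub>v v"
proof (rule eq_vecI)
  (* By definition an eigenvector is nonzero, so the zero vector is a separate case. *)
  have pow: "(A ^\<^sub>m k) *\<^sub>v v = c ^ k \<cdot>\<^sub>v v" for k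
  proof (cases "v = 0\<^sub>v n")
    case True
    then show ?thesis
      using carrier_matD[OF pow_carrier_mat[OF A, of k]]
      by (intro eq_vecI) (simp_all add: scalar_prod_def)
  next
    case False
    then show ?thesis
      using eigenvector_pow[OF A, of v c] A v eig by (simp add: eigenvector_def)
  qed
  show dim: "dim_vec (mat_exp A *\<^sub>v v) = dim_vec (exp c \<cdot>\<^sub>v v)"
    using A v by (simp add: mat_exp_def)
  fix i assume "i < dim_vec (exp c \<cdot>\<^sub>v v)"
  then have i: "i < n" using v by simp
  have "(\<lambda>k. \<Sum>j<n. (A ^\<^sub>m k) $$ (i, j) / fact k * v $ j) sums
          (\<Sum>j<n. mat_exp A $$ (i, j) * v $ j)"
    by (intro sums_sum sums_mult2 mat_exp_sums[OF A i]) simp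
  also have "(\<lambda>k. \<Sum>j<n. (A ^\<^sub>m k) $$ (i, j) / fact k * v $ j) = (\<lambda>k. c ^ k / fact k * v $ i)"
  proof
    fix k
    have "(\<Sum>j<n. (A ^\<^sub>m k) $$ (i, j) * v $ j) = ((A ^\<^sub>m k) *\<^sub>v v) $ i"
      using carrier_matD[OF pow_carrier_mat[OF A, of k]] v i
      by (simp add: scalar_prod_def atLeast0LessThan)
    also have "\<dots> = c ^ k * v $ i"
      using pow v i by simp
    finally show "(\<Sum>j<n. (A ^\<^sub>m k) $$ (i, j) / fact k * v $ j) = c ^ k / fact k * v $ i"
      by (simp flip: sum_divide_distrib)
  qed
  finally have "(\<lambda>k. c ^ k / fact k * v $ i) sums (\<Sum>j<n. mat_exp A $$ (i, j) * v $ j)" .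
  moreover have "(\<lambda>k. c ^ k / fact k * v $ i) sums (exp c * v $ i)"
    using sums_mult2[OF exp_converges[of c], of "v $ i"]
    by (simp add: scaleR_conv_of_real field_simps)
  ultimately have "(\<Sum>j<n. mat_exp A $$ (i, j) * v $ j) = exp c * v $ i"
    by (rule sums_unique2)
  then show "(mat_exp A *\<^sub>v v) $ i = (exp c \<cdot>\<^sub>v v) $ i"
    using A v i by (simp add: mat_exp_def scalar_prod_def atLeast0LessThan)
qed

text \<open>
  On the plane spanned by \<open>x\<close> and \<open>y\<close> the exponential is \<open>exp \<alpha>\<close> times a combination of the
  identity, with coefficient \<open>cosh \<beta>\<close>, and the swap of \<open>x\<close> and \<open>y\<close>, with coefficient
  \<open>sinh \<beta>\<close>. The condition on \<open>\<beta>\<close> says that \<open>cosh \<beta> = 0\<close>, which leaves only the swap.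
\<close>

lemma mat_exp_swap:
  assumes M: "M \<in> carrier_mat n n" and x: "x \<in> carrier_vec n" and y: "y \<in> carrier_vec n"
    and Mx: "M *\<^sub>v x = \<alpha> \<cdot>\<^sub>v x + \<beta> \<cdot>\<^sub>v y"
    and My: "M *\<^sub>v y = \<beta> \<cdot>\<^sub>v x + \<alpha> \<cdot>\<^sub>v y"
    and opposite: "exp (- \<beta>) = - exp \<beta>"
  shows "mat_exp M *\<^sub>v x = exp (\<alpha> + \<beta>) \<cdot>\<^sub>v y"
proof -
  let ?E = "mat_exp M"
  have E: "?E \<in> carrier_mat n n"
    using M by (simp add: mat_exp_def)
  have "M *\<^sub>v (x + y) = (\<alpha> + \<beta>) \<cdot>\<^sub>v (x + y)"
    unfolding mult_add_distrib_mat_vec[OF M x y] Mx My using x y by (auto simp: algebra_simps)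
  then have plus: "?E *\<^sub>v x + ?E *\<^sub>v y = exp (\<alpha> + \<beta>) \<cdot>\<^sub>v (x + y)"
    using mat_exp_mult_eigenvector[OF M, of "x + y"] x y mult_add_distrib_mat_vec[OF E x y]
    by simp
  have "M *\<^sub>v (x - y) = (\<alpha> - \<beta>) \<cdot>\<^sub>v (x - y)"
    unfolding mult_minus_distrib_mat_vec[OF M x y] Mx My using x y by (auto simp: algebra_simps)
  then have "?E *\<^sub>v x - ?E *\<^sub>v y = exp (\<alpha> - \<beta>) \<cdot>\<^sub>v (x - y)"
    using mat_exp_mult_eigenvector[OF M, of "x - y"] x y mult_minus_distrib_mat_vec[OF E x y]
    by simp
  also have "exp (\<alpha> - \<beta>) = - exp (\<alpha> + \<beta>)"
    using exp_add[of \<alpha> "- \<beta>"] by (simp add: opposite exp_add)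
  finally have minus: "?E *\<^sub>v x - ?E *\<^sub>v y = - exp (\<alpha> + \<beta>) \<cdot>\<^sub>v (x - y)" .
  show ?thesis
  proof (rule eq_vecI)
    fix i assume "i < dim_vec (exp (\<alpha> + \<beta>) \<cdot>\<^sub>v y)"
    then have i: "i < n" using y by simp
    define a b g where "a = (?E *\<^sub>v x) $ i" and "b = (?E *\<^sub>v y) $ i" and "g = exp (\<alpha> + \<beta>)"
    have "a + b = g * (x $ i + y $ i)"
      using arg_cong[OF plus, of "\<lambda>v. v $ i"] E x y i
      unfolding a_def b_def g_def by (simp del: index_mult_mat_vec)
    moreover have "a - b = - g * (x $ i - y $ i)"
      using arg_cong[OF minus, of "\<lambda>v. v $ i"] E x y i
      unfolding a_def b_def g_def by (simp del: index_mult_mat_vec)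
    ultimately have "(a + b) + (a - b) = g * (x $ i + y $ i) + - g * (x $ i - y $ i)"
      by (simp only:)
    then have "2 * a = 2 * (g * y $ i)"
      by (simp add: algebra_simps)
    then show "(?E *\<^sub>v x) $ i = (exp (\<alpha> + \<beta>) \<cdot>\<^sub>v y) $ i"
      using y i by (simp add: a_def g_def)
  qed (use E y in simp)
qed

section \<open>Pair states\<close>

lemma lin_indep_pairI:
  assumes x: "x \<in> carrier_vec n" and y: "y \<in> carrier_vec n" and ij: "i < n" "j < n"
    and "x $ i \<noteq> 0" "y $ i = 0" "x $ j = 0" "y $ j \<noteq> 0"
  shows "lin_indep_pair n x y"
proof -
  interpret vec_space "TYPE(complex)" n .
  have neq: "x \<noteq> y" using assms by auto
  have "\<not> lin_dep {x, y}"
  proof (rule finite_lin_indpt2)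
    fix a :: "complex vec \<Rightarrow> complex"
    assume zero: "lincomb a {x, y} = 0\<^sub>v n"
    have "lincomb a {x, y} $ k = a x * x $ k + a y * y $ k" if "k < n" for k
      using lincomb_index[OF that, of "{x, y}" a] x y neq by simp
    then have "a x * x $ k + a y * y $ k = 0" if "k < n" for k
      using that zero by simp
    from this[OF ij(1)] this[OF ij(2)] show "\<forall>v\<in>{x, y}. a v = 0"
      using assms by simp
  qed (use x y in auto)
  with neq show ?thesis
    by (simp add: lin_indep_pair_def)
qed

lemma mult_mat_vec_unit_diff:
  fixes A :: "'a :: field mat"
  assumes "A \<in> carrier_mat n n" "a < n" "b < n" "i < n"
  shows "(A *\<^sub>v (c \<cdot>\<^sub>v (unit_vec n a - unit_vec n b))) $ i = c * (A $$ (i, a) - A $$ (i, b))"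
proof -
  have "A *\<^sub>v (c \<cdot>\<^sub>v (unit_vec n a - unit_vec n b))
      = c \<cdot>\<^sub>v (A *\<^sub>v unit_vec n a - A *\<^sub>v unit_vec n b)"
    using assms(1) by (simp add: mult_mat_vec mult_minus_distrib_mat_vec)
  then show ?thesis
    using assms by (simp del: index_mult_mat_vec) simp
qed

section \<open>The path with two chords\<close>

definition chorded_path :: "nat \<Rightarrow> nat set set" where
  "chorded_path n = path_edges n \<union> {{2, n - 2}, {3, n - 1}}"

lemma graph_degree_eq_card_neighbours:
  assumes "\<And>e. e \<in> E \<Longrightarrow> v \<in> e \<Longrightarrow> \<exists>u. e = {u, v}"
  shows "graph_degree E v = card {u. {u, v} \<in> E}"
proof -
  have "{e \<in> E. v \<in> e} = (\<lambda>u. {u, v}) ` {u. {u, v} \<in> E}"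
    using assms by auto
  moreover have "inj_on (\<lambda>u. {u, v}) {u. {u, v} \<in> E}"
    by (auto simp: inj_on_def doubleton_eq_iff)
  ultimately show ?thesis
    by (simp add: graph_degree_def card_image)
qed

lemma path_edges_iff:
  "{j, k} \<in> path_edges n \<longleftrightarrow>
     1 \<le> j \<and> j \<le> n \<and> 1 \<le> k \<and> k \<le> n \<and> (j = Suc k \<or> k = Suc j)"
proof -
  have "\<bar>int a - int b\<bar> = 1 \<longleftrightarrow> a = Suc b \<or> b = Suc a" for a b
    by linarith
  then show ?thesis
    by (auto simp: path_edges_def doubleton_eq_iff)
qed

lemma chorded_path_iff:
  "{j, k} \<in> chorded_path n \<longleftrightarrow>
     1 \<le> j \<and> j \<le> n \<and> 1 \<le> k \<and> k \<le> n \<and> (j = Suc k \<or> k = Suc j)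
     \<or> j = 2 \<and> k = n - 2 \<or> j = n - 2 \<and> k = 2 \<or> j = 3 \<and> k = n - 1 \<or> j = n - 1 \<and> k = 3"
  unfolding chorded_path_def Un_iff path_edges_iff by (auto simp: doubleton_eq_iff)

text \<open>
  Each chord gives \<open>2\<close> and \<open>n - 1\<close> the neighbour that they lacked to have \<open>3\<close> and \<open>n - 2\<close> in
  common. For \<open>n \<ge> 6\<close> these two vertices are distinct, so that \<open>2\<close> and \<open>n - 1\<close> have degree \<open>3\<close>.
\<close>

lemma chorded_path_neighbours:
  assumes "n \<ge> 6"
  shows "{u, 1} \<in> chorded_path n \<longleftrightarrow> u = 2"
    and "{u, n} \<in> chorded_path n \<longleftrightarrow> u = n - 1"
    and "{u, 2} \<in> chorded_path n \<longleftrightarrow> u \<in> {1, 3, n - 2}"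
    and "{u, n - 1} \<in> chorded_path n \<longleftrightarrow> u \<in> {n, n - 2, 3}"
  unfolding chorded_path_iff insert_iff empty_iff using assms by presburger+

lemma chorded_path_degree:
  assumes n: "n \<ge> 6"
  shows "graph_degree (chorded_path n) 1 = 1" "graph_degree (chorded_path n) n = 1"
    "graph_degree (chorded_path n) 2 = 3" "graph_degree (chorded_path n) (n - 1) = 3"
proof -
  have deg: "graph_degree (chorded_path n) v = card {u. {u, v} \<in> chorded_path n}" for v
    by (rule graph_degree_eq_card_neighbours)
       (auto simp: chorded_path_def path_edges_def insert_commute)
  show "graph_degree (chorded_path n) 1 = 1" "graph_degree (chorded_path n) n = 1"
    unfolding deg chorded_path_neighbours[OF n] by simp_all
  show "graph_degree (chorded_path n) 2 = 3" "graph_degree (chorded_path n) (n - 1) = 3"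
    unfolding deg chorded_path_neighbours[OF n] Collect_mem_eq
    using n by (simp_all add: card_insert_if)
qed

definition end_potential :: "nat \<Rightarrow> nat \<Rightarrow> real" where
  "end_potential n v = (if v = 1 \<or> v = n then 2 else 0)"

lemma q_laplacian_carrier [simp]: "q_laplacian n E \<eta> q \<in> carrier_mat n n"
  by (rule carrier_matI) (simp_all add: q_laplacian_def adjacency_mat_def vertex_diag_mat_def)

lemma q_laplacian_entry:
  assumes "i < n" "j < n"
  shows "q_laplacian n E \<eta> q $$ (i, j) =
    (if i = j then 1 - q\<^sup>2 + q\<^sup>2 * (real (graph_degree E (Suc j)) + \<eta> (Suc j)) else 0)
      - (if {Suc i, Suc j} \<in> E then q else 0)"
  using assms by (simp add: q_laplacian_def adjacency_mat_def vertex_diag_mat_def)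

text \<open>
  Entry \<open>i\<close> belongs to vertex \<open>i + 1\<close>. In the second equation the entries of \<open>3\<close> and \<open>n - 2\<close>
  cancel. The diagonal entries are equal because degree plus potential is \<open>1 + 2\<close> at the ends
  and \<open>3 + 0\<close> at their neighbours.
\<close>

lemma q_laplacian_chorded_path_column_differences:
  fixes q :: real
  assumes n: "n \<ge> 6" and i: "i < n"
  defines "L \<equiv> q_laplacian n (chorded_path n) (end_potential n) q"
  shows "L $$ (i, 0) - L $$ (i, n - 1)
           = (1 + 2 * q\<^sup>2) * (of_bool (i = 0) - of_bool (i = n - 1))
             - q * (of_bool (i = 1) - of_bool (i = n - 2))" (is ?ends)
    and "L $$ (i, 1) - L $$ (i, n - 2)
           = (1 + 2 * q\<^sup>2) * (of_bool (i = 1) - of_bool (i = n - 2))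
             - q * (of_bool (i = 0) - of_bool (i = n - 1))" (is ?inner)
proof -
  have Suc_eqs: "Suc 0 = 1" "Suc (n - 1) = n" "Suc 1 = 2" "Suc (n - 2) = n - 1"
    using n by simp_all
  have lt: "0 < n" "n - 1 < n" "1 < n" "n - 2 < n"
    using n by simp_all
  have \<eta>: "end_potential n 1 = 2" "end_potential n n = 2" "end_potential n 2 = 0"
    "end_potential n (n - 1) = 0"
    using n by (auto simp: end_potential_def)
  have adj: "Suc i = 2 \<longleftrightarrow> i = 1" "Suc i = n - 1 \<longleftrightarrow> i = n - 2"
    "Suc i \<in> {1, 3, n - 2} \<longleftrightarrow> i = 0 \<or> (i = 2 \<or> i = n - 3)"
    "Suc i \<in> {n, n - 2, 3} \<longleftrightarrow> i = n - 1 \<or> (i = 2 \<or> i = n - 3)"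
    unfolding insert_iff empty_iff using n by presburger+
  note entry = L_def q_laplacian_entry[OF i lt(1)] q_laplacian_entry[OF i lt(2)]
    q_laplacian_entry[OF i lt(3)] q_laplacian_entry[OF i lt(4)]
    Suc_eqs chorded_path_neighbours[OF n] chorded_path_degree[OF n] \<eta> adj
  have L0: "L $$ (i, 0) = (1 + 2 * q\<^sup>2) * of_bool (i = 0) - q * of_bool (i = 1)"
    unfolding entry by simp
  have Ln: "L $$ (i, n - 1) = (1 + 2 * q\<^sup>2) * of_bool (i = n - 1) - q * of_bool (i = n - 2)"
    unfolding entry by simp
  have L1: "L $$ (i, 1) = (1 + 2 * q\<^sup>2) * of_bool (i = 1)
      - q * of_bool (i = 0 \<or> (i = 2 \<or> i = n - 3))"
    unfolding entry by simp
  have Ln1: "L $$ (i, n - 2) = (1 + 2 * q\<^sup>2) * of_bool (i = n - 2)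
      - q * of_bool (i = n - 1 \<or> (i = 2 \<or> i = n - 3))"
    unfolding entry by simp
  show ?ends
    unfolding L0 Ln by (simp only: algebra_simps)
  show ?inner
  proof (cases "i = 2 \<or> i = n - 3")
    case True
    then have "i \<noteq> 0" "i \<noteq> n - 1"
      using n by presburger+
    with True show ?thesis
      unfolding L1 Ln1 by (simp add: algebra_simps)
  next
    case False
    then show ?thesis
      unfolding L1 Ln1 by (simp add: algebra_simps)
  qed
qed

theorem theorem13:
  fixes q :: real and n :: nat
  assumes "q \<noteq> 0" and "n \<ge> 6"
  shows "q_laplacian_perfect_pair_state_transfer n
           (path_edges n \<union> {{2, n - 2}, {3, n - 1}})
           (\<lambda>v. if v = 1 \<or> v = n then 2 else 0) q"
proof -
  note n = \<open>n \<ge> 6\<close>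
  define s where "s = complex_of_real (1 / sqrt 2)"
  define x where "x = s \<cdot>\<^sub>v (unit_vec n 0 - unit_vec n (n - 1))"
  define y where "y = s \<cdot>\<^sub>v (unit_vec n 1 - unit_vec n (n - 2))"
  define L where "L = q_laplacian n (chorded_path n) (end_potential n) q"
  define \<tau> where "\<tau> = pi / (2 * \<bar>q\<bar>)"
  define t where "t = \<i> * complex_of_real \<tau>"
  define M where "M = t \<cdot>\<^sub>m map_mat complex_of_real L"
  define \<alpha> where "\<alpha> = t * complex_of_real (1 + 2 * q\<^sup>2)"
  define \<beta> where "\<beta> = - t * complex_of_real q"

  have s: "s \<noteq> 0"
    by (simp add: s_def)
  have L: "L \<in> carrier_mat n n" and M: "M \<in> carrier_mat n n"
    and x: "x \<in> carrier_vec n" and y: "y \<in> carrier_vec n"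
    by (auto simp: L_def M_def x_def y_def)
  have M_entry: "M $$ (i, j) = t * complex_of_real (L $$ (i, j))" if "i < n" "j < n" for i j
    using L that by (simp add: M_def)
  note columns = q_laplacian_chorded_path_column_differences[OF n, where q = q, folded L_def]
  have difference: "(s \<cdot>\<^sub>v (unit_vec n a - unit_vec n b)) $ i = s * (of_bool (i = a) - of_bool (i = b))"
    if "i < n" "a < n" "b < n" for i a b
    using that by simp
  have xy: "x $ i = s * (of_bool (i = 0) - of_bool (i = n - 1))"
    "y $ i = s * (of_bool (i = 1) - of_bool (i = n - 2))" if "i < n" for i
    unfolding x_def y_def by (rule difference; use n that in simp)+

  have Mx: "M *\<^sub>v x = \<alpha> \<cdot>\<^sub>v x + \<beta> \<cdot>\<^sub>v y"
  proof (rule eq_vecI)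
    fix i assume "i < dim_vec (\<alpha> \<cdot>\<^sub>v x + \<beta> \<cdot>\<^sub>v y)"
    then have i: "i < n" using x y by simp
    have "(M *\<^sub>v x) $ i = s * (M $$ (i, 0) - M $$ (i, n - 1))"
      unfolding x_def using n i by (intro mult_mat_vec_unit_diff[OF M]) auto
    also have "\<dots> = s * t * complex_of_real (L $$ (i, 0) - L $$ (i, n - 1))"
      using n i by (simp add: M_entry algebra_simps)
    also have "\<dots> = (\<alpha> \<cdot>\<^sub>v x + \<beta> \<cdot>\<^sub>v y) $ i"
      unfolding columns[OF i] using x y i
      by (simp add: xy[OF i] \<alpha>_def \<beta>_def algebra_simps del: of_bool_eq_iff)
    finally show "(M *\<^sub>v x) $ i = (\<alpha> \<cdot>\<^sub>v x + \<beta> \<cdot>\<^sub>v y) $ i" .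
  qed (use M x y in auto)
  have My: "M *\<^sub>v y = \<beta> \<cdot>\<^sub>v x + \<alpha> \<cdot>\<^sub>v y"
  proof (rule eq_vecI)
    fix i assume "i < dim_vec (\<beta> \<cdot>\<^sub>v x + \<alpha> \<cdot>\<^sub>v y)"
    then have i: "i < n" using x y by simp
    have "(M *\<^sub>v y) $ i = s * (M $$ (i, 1) - M $$ (i, n - 2))"
      unfolding y_def using n i by (intro mult_mat_vec_unit_diff[OF M]) auto
    also have "\<dots> = s * t * complex_of_real (L $$ (i, 1) - L $$ (i, n - 2))"
      using n i by (simp add: M_entry algebra_simps)
    also have "\<dots> = (\<beta> \<cdot>\<^sub>v x + \<alpha> \<cdot>\<^sub>v y) $ i"
      unfolding columns[OF i] using x y i
      by (simp add: xy[OF i] \<alpha>_def \<beta>_def algebra_simps del: of_bool_eq_iff)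
    finally show "(M *\<^sub>v y) $ i = (\<beta> \<cdot>\<^sub>v x + \<alpha> \<cdot>\<^sub>v y) $ i" .
  qed (use M x y in auto)

  (* The sign of q decides between i pi/2 and - i pi/2; in both cases the exponentials are i and - i. *)
  have "\<tau> * q = pi / 2 \<or> \<tau> * q = - (pi / 2)"
    using \<open>q \<noteq> 0\<close> by (auto simp: \<tau>_def abs_if)
  moreover have "exp (- \<beta>) = cis (\<tau> * q)" "exp \<beta> = cis (- (\<tau> * q))"
    by (simp_all add: \<beta>_def t_def cis_conv_exp mult.assoc)
  ultimately have "exp (- \<beta>) = - exp \<beta>"
    by (elim disjE) (simp_all add: complex_eq_iff)
  then have transfer: "mat_exp M *\<^sub>v x = exp (\<alpha> + \<beta>) \<cdot>\<^sub>v y"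
    by (rule mat_exp_swap[OF M x y Mx My])

  have "pair_state n x"
    unfolding pair_state_def
    by (rule bexI[of _ 1], rule bexI[of _ n])
       (use n in \<open>auto simp: x_def s_def char_vec_def\<close>)
  moreover have "pair_state n y"
    unfolding pair_state_def
    by (rule bexI[of _ 2], rule bexI[of _ "n - 1"])
       (use n in \<open>auto simp: y_def s_def char_vec_def numeral_2_eq_2\<close>)
  moreover have "lin_indep_pair n x y"
    by (rule lin_indep_pairI[OF x y, of 0 1]) (use n s in \<open>auto simp: x_def y_def\<close>)
  moreover have "\<tau> > 0"
    using \<open>q \<noteq> 0\<close> by (simp add: \<tau>_def)
  ultimately show ?thesis
    using transfer
    unfolding q_laplacian_perfect_pair_state_transfer_def M_def t_def L_def chorded_path_def
      end_potential_def[abs_def] by blast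
qed

end
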